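(* Let $f_\theta$ be a transformer with $L$ layers and position-shared weights, with parameter vector $\theta\in\mathbb{R}^p$. Let $\mathcal{G}$ and $\bar{\mathcal{G}}$ partition the output positions into ground-truth (GT) and non-GT sets, with losses $\mathcal{L}_{\mathcal{G}},\mathcal{L}_{\bar{\mathcal{G}}}$, differentiable functions of the parameters. At a parameter value $\theta$ with $\nabla_\theta\mathcal{L}_{\mathcal{G}}(\theta)\neq 0$, define the gradient coupling coefficient $$\gamma := \frac{\langle \nabla_\theta \mathcal{L}_{\bar{\mathcal{G}}}(\theta),\, \nabla_\theta \mathcal{L}_{\mathcal{G}}(\theta)\rangle}{\|\nabla_\theta \mathcal{L}_{\mathcal{G}}(\theta)\|^2}.$$ Suppose: (A1) (Smoothness) $\mathcal{L}_{\bar{\mathcal{G}}}$ is $\beta$-smooth: $\|\nabla\mathcal{L}_{\bar{\mathcal{G}}}(\theta_1)-\nabla\mathcal{L}_{\bar{\mathcal{G}}}(\theta_2)\|\le \beta\|\theta_1-\theta_2\|$ for all $\theta_1,\theta_2$, where $\beta>0$; (A2) (Positive coupling) $\gamma>0$; (A3) (Small learning rate) $0<\eta<2\gamma/\beta$. Then a single gradient step $\theta'=\theta-\eta\,\nabla_\theta\mathcal{L}_{\mathcal{G}}(\theta)$ on the GT tokens decreases the non-GT loss: $$\mathcal{L}_{\bar{\mathcal{G}}}(\theta')\le \mathcal{L}_{\bar{\mathcal{G}}}(\theta)-\eta\Bigl(\gamma-\frac{\beta\eta}{2}\Bigr)\|\nabla_\theta\mathcal{L}_{\mathcal{G}}(\theta)\|^2,$$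 i.e. $\Delta_{\bar{\mathcal{G}}}:=\mathcal{L}_{\bar{\mathcal{G}}}(\theta)-\mathcal{L}_{\bar{\mathcal{G}}}(\theta')$ satisfies $$\Delta_{\bar{\mathcal{G}}}\ge \eta\Bigl(\gamma-\frac{\beta\eta}{2}\Bigr)\|\nabla_\theta\mathcal{L}_{\mathcal{G}}(\theta)\|^2>0$$ under (A3). Equivalently, the wave factor $\mathcal{W}=\Delta_{\bar{\mathcal{G}}}/\Delta_{\mathcal{G}}$, where $\Delta_{\mathcal{G}}:=\mathcal{L}_{\mathcal{G}}(\theta)-\mathcal{L}_{\mathcal{G}}(\theta')$, satisfies $$\mathcal{W}\ge\gamma-\frac{\beta\eta}{2}\quad\text{to first order in }\eta.$$
   Context: $\langle\cdot,\cdot\rangle$ and $\|\cdot\|$ are the Euclidean inner product and norm on $\mathbb{R}^p$. For a response $\mathbf{y}=(y_1,\dots,y_m)$, the output positions are $\{1,\dots,m\}$; $\mathcal{G}$ is the set of "ground truth" positions (the semantically decisive tokens singled out for supervision) and $\bar{\mathcal{G}}$ its complement, both nonempty. The loss attached to a set $S$ of positions is the average token loss $\mathcal{L}_S(\theta)=\frac{1}{|S|}\sum_{i\in S}\ell(f_\theta(\mathbf{y}_{<i}),y_i)$, where $\ell$ is the per-token (cross-entropy) loss and $\mathbf{y}_{<i}$ is the preceding context. "Position-shared weights" means the same parameter vector $\theta$ is used at all positions, so that $\mathcal{L}_{\mathcal{G}}$ and $\mathcal{L}_{\bar{\mathcal{G}}}$ are functions of one common $\theta$. The wave factor $\mathcal{W}$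 is the ratio of the non-GT loss reduction to the GT loss reduction; here both reductions are those produced by the single step $\theta\mapsto\theta'$, a plain gradient step on $\mathcal{L}_{\mathcal{G}}$ with learning rate $\eta$. *)

theory Defs
  imports "HOL-Analysis.Analysis" "HOL-Library.Landau_Symbols"
begin

section \<open>Transformers\<close>

text \<open>
  A causal (decoder-only) transformer over the vocabulary \<open>'v\<close>, with model width \<open>'d\<close>, head
  width \<open>'k\<close> and parameter space \<open>real ^ 'p\<close>. The weights depend on the parameter vector and on
  the layer (and head) index, never on the position, so they are shared by all positions; only
  the positional encodings see a position. The position-wise maps are left unspecified:
  \<open>query\<close>, \<open>key\<close>, \<open>val\<close> and \<open>ffn\<close> are meant to be the usual linear or affine
  projections and feed-forward networks, composed with the pre-normalisation if there is one.
  Post-normalisations are \<open>norm_attn\<close> and \<open>norm_ffn\<close> (identities in a pre-norm transformer),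
  and \<open>unembed\<close> includes the final normalisation. Positions may enter through an additive
  encoding \<open>pos\<close>, through a parameter-free map \<open>rot\<close> applied to queries and keys (rotary
  encodings), or both. \<open>prompt\<close> is what precedes the response, at least a
  beginning-of-sequence token.
\<close>

record ('v, 'd, 'k, 'p) transformer =
  prompt :: "'v list"
  heads :: nat
  embed :: "real ^ 'p \<Rightarrow> 'v \<Rightarrow> real ^ 'd"
  pos :: "real ^ 'p \<Rightarrow> nat \<Rightarrow> real ^ 'd"
  rot :: "nat \<Rightarrow> real ^ 'k \<Rightarrow> real ^ 'k"
  query :: "real ^ 'p \<Rightarrow> nat \<Rightarrow> nat \<Rightarrow> real ^ 'd \<Rightarrow> real ^ 'k"
  key :: "real ^ 'p \<Rightarrow> nat \<Rightarrow> nat \<Rightarrow> real ^ 'd \<Rightarrow> real ^ 'k"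
  val :: "real ^ 'p \<Rightarrow> nat \<Rightarrow> nat \<Rightarrow> real ^ 'd \<Rightarrow> real ^ 'k"
  out :: "real ^ 'p \<Rightarrow> nat \<Rightarrow> nat \<Rightarrow> real ^ 'k ^ 'd"
  norm_attn :: "real ^ 'p \<Rightarrow> nat \<Rightarrow> real ^ 'd \<Rightarrow> real ^ 'd"
  ffn :: "real ^ 'p \<Rightarrow> nat \<Rightarrow> real ^ 'd \<Rightarrow> real ^ 'd"
  norm_ffn :: "real ^ 'p \<Rightarrow> nat \<Rightarrow> real ^ 'd \<Rightarrow> real ^ 'd"
  unembed :: "real ^ 'p \<Rightarrow> real ^ 'd \<Rightarrow> real ^ 'v"

text \<open>
  Sequences of hidden states are functions on \<open>nat\<close>. Attention at position \<open>i\<close> ranges over the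
  positions \<open>j \<le> i\<close>, so values beyond the end of the input are never used.
\<close>

definition attn_score ::
  "('v::finite, 'd::finite, 'k::finite, 'p::finite) transformer \<Rightarrow> real ^ 'p \<Rightarrow> nat \<Rightarrow> nat \<Rightarrow>
    (nat \<Rightarrow> real ^ 'd) \<Rightarrow> nat \<Rightarrow> nat \<Rightarrow> real" where
  "attn_score T \<theta> l h x i j =
    (rot T i (query T \<theta> l h (x i)) \<bullet> rot T j (key T \<theta> l h (x j))) / sqrt (real CARD('k))"

definition attn_weight ::
  "('v::finite, 'd::finite, 'k::finite, 'p::finite) transformer \<Rightarrow> real ^ 'p \<Rightarrow> nat \<Rightarrow> nat \<Rightarrow>
    (nat \<Rightarrow> real ^ 'd) \<Rightarrow> nat \<Rightarrow> nat \<Rightarrow> real" where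
  "attn_weight T \<theta> l h x i j =
    exp (attn_score T \<theta> l h x i j) / (\<Sum>j'\<le>i. exp (attn_score T \<theta> l h x i j'))"

text \<open>
  Concatenating the heads and applying one output matrix is the same as summing the heads,
  each multiplied by its own block \<open>out\<close> of that matrix.
\<close>

definition attention ::
  "('v::finite, 'd::finite, 'k::finite, 'p::finite) transformer \<Rightarrow> real ^ 'p \<Rightarrow> nat \<Rightarrow>
    (nat \<Rightarrow> real ^ 'd) \<Rightarrow> nat \<Rightarrow> real ^ 'd" where
  "attention T \<theta> l x i =
    (\<Sum>h<heads T. out T \<theta> l h *v (\<Sum>j\<le>i. attn_weight T \<theta> l h x i j *\<^sub>R val T \<theta> l h (x j)))"

definition layer ::
  "('v::finite, 'd::finite, 'k::finite, 'p::finite) transformer \<Rightarrow> real ^ 'p \<Rightarrow> nat \<Rightarrow>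
    (nat \<Rightarrow> real ^ 'd) \<Rightarrow> nat \<Rightarrow> real ^ 'd" where
  "layer T \<theta> l x i =
    (let u = norm_attn T \<theta> l (x i + attention T \<theta> l x i)
     in norm_ffn T \<theta> l (u + ffn T \<theta> l u))"

primrec hidden ::
  "('v::finite, 'd::finite, 'k::finite, 'p::finite) transformer \<Rightarrow> real ^ 'p \<Rightarrow>
    (nat \<Rightarrow> real ^ 'd) \<Rightarrow> nat \<Rightarrow> nat \<Rightarrow> real ^ 'd" where
  "hidden T \<theta> x 0 = x"
| "hidden T \<theta> x (Suc l) = layer T \<theta> l (hidden T \<theta> x l)"

text \<open>The next-token logits computed from the context \<open>c\<close> by a transformer with \<open>L\<close> layers.\<close>

definition run_transformer ::
  "('v::finite, 'd::finite, 'k::finite, 'p::finite) transformer \<Rightarrow> nat \<Rightarrow> real ^ 'p \<Rightarrow>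
    'v list \<Rightarrow> real ^ 'v" where
  "run_transformer T L \<theta> c =
    (let s = prompt T @ c
     in unembed T \<theta> (hidden T \<theta> (\<lambda>i. embed T \<theta> (s ! i) + pos T \<theta> i) L (length s - 1)))"

section \<open>Losses\<close>

definition softmax :: "real ^ 'v \<Rightarrow> 'v::finite \<Rightarrow> real" where
  "softmax z v = exp (z $ v) / (\<Sum>w\<in>UNIV. exp (z $ w))"

definition cross_entropy :: "real ^ 'v \<Rightarrow> 'v::finite \<Rightarrow> real" where
  "cross_entropy z v = - ln (softmax z v)"

text \<open>
  The response is \<open>y 1, \<dots>, y m\<close>; \<open>map y [1..<i]\<close> lists the tokens before position \<open>i\<close>. All
  positions are evaluated at the same \<open>\<theta>\<close>.
\<close>

definition avg_loss ::
  "(real ^ 'p \<Rightarrow> 'v list \<Rightarrow> real ^ 'v) \<Rightarrow> (nat \<Rightarrow> 'v::finite) \<Rightarrow> nat set \<Rightarrow> real ^ 'p::finite \<Rightarrow> real" where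
  "avg_loss f y S \<theta> =
    (1 / real (card S)) * (\<Sum>i\<in>S. cross_entropy (f \<theta> (map y [1..<i])) (y i))"

section \<open>Gradient steps\<close>

definition gradient :: "('a::real_inner \<Rightarrow> real) \<Rightarrow> 'a \<Rightarrow> 'a" where
  "gradient F x = (THE D. GDERIV F x :> D)"

definition beta_smooth :: "real \<Rightarrow> ('a::real_inner \<Rightarrow> real) \<Rightarrow> bool" where
  "beta_smooth \<beta> F \<longleftrightarrow>
    (\<forall>\<theta>1 \<theta>2. norm (gradient F \<theta>1 - gradient F \<theta>2) \<le> \<beta> * norm (\<theta>1 - \<theta>2))"

definition grad_coupling :: "('a::real_inner \<Rightarrow> real) \<Rightarrow> ('a \<Rightarrow> real) \<Rightarrow> 'a \<Rightarrow> real" where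
  "grad_coupling LN LG \<theta> = (gradient LN \<theta> \<bullet> gradient LG \<theta>) / (norm (gradient LG \<theta>))\<^sup>2"

definition grad_step :: "('a::real_inner \<Rightarrow> real) \<Rightarrow> real \<Rightarrow> 'a \<Rightarrow> 'a" where
  "grad_step F \<eta> \<theta> = \<theta> - \<eta> *\<^sub>R gradient F \<theta>"

text \<open>The decrease of \<open>F\<close> under a gradient step on the possibly different loss \<open>LG\<close>.\<close>

definition loss_reduction :: "('a::real_inner \<Rightarrow> real) \<Rightarrow> ('a \<Rightarrow> real) \<Rightarrow> real \<Rightarrow> 'a \<Rightarrow> real" where
  "loss_reduction F LG \<eta> \<theta> = F \<theta> - F (grad_step LG \<eta> \<theta>)"

definition wave_factor :: "('a::real_inner \<Rightarrow> real) \<Rightarrow> ('a \<Rightarrow> real) \<Rightarrow> real \<Rightarrow> 'a \<Rightarrow> real" where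
  "wave_factor LN LG \<eta> \<theta> = loss_reduction LN LG \<eta> \<theta> / loss_reduction LG LG \<eta> \<theta>"

text \<open>
  \<open>W \<ge> \<gamma> - \<beta> \<eta> / 2\<close> to first order in \<open>\<eta>\<close>, where \<open>W\<close> is the wave factor. The approximation is
  the replacement of its denominator by the first-order term \<open>\<eta> * (norm (gradient LG \<theta>))\<^sup>2\<close>.
  The first conjunct says that this is the first-order expansion of the denominator, the second
  that the bound holds exactly after the replacement for every admissible \<open>\<eta>\<close>, and the third
  what this means for \<open>W\<close> itself: its denominator is positive and the bound holds up to a
  factor \<open>1 + o(1)\<close>. An error \<open>o(\<eta>)\<close> in the last bound would be false: it would need control of
  the second-order term of \<open>LG\<close>.
\<close>

definition wave_bound_first_order ::
  "('a::real_inner \<Rightarrow> real) \<Rightarrow> ('a \<Rightarrow> real) \<Rightarrow> 'a \<Rightarrow> real \<Rightarrow> real \<Rightarrow> bool" where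
  "wave_bound_first_order LN LG \<theta> \<gamma> \<beta> \<longleftrightarrow>
    (\<lambda>\<eta>. loss_reduction LG LG \<eta> \<theta> - \<eta> * (norm (gradient LG \<theta>))\<^sup>2) \<in> o[at_right 0](\<lambda>\<eta>. \<eta>) \<and>
    (\<forall>\<eta>. 0 < \<eta> \<and> \<eta> < 2 * \<gamma> / \<beta> \<longrightarrow>
      loss_reduction LN LG \<eta> \<theta> / (\<eta> * (norm (gradient LG \<theta>))\<^sup>2) \<ge> \<gamma> - \<beta> * \<eta> / 2) \<and>
    (\<exists>\<rho>. (\<rho> \<longlongrightarrow> 0) (at_right 0) \<and>
      (\<forall>\<^sub>F \<eta> in at_right 0. loss_reduction LG LG \<eta> \<theta> > 0 \<and>
        wave_factor LN LG \<eta> \<theta> \<ge> (\<gamma> - \<beta> * \<eta> / 2) * (1 + \<rho> \<eta>)))"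

end

theory Submission imports Defs begin

text \<open>
  Along the segment from \<open>x\<close> to \<open>x + v\<close>, smoothness makes the derivative of
  \<open>F (x + t *\<^sub>R v) - t * (gradient F x \<bullet> v) - \<beta> / 2 * t\<^sup>2 * (norm v)\<^sup>2\<close> nonpositive, so the
  function does not increase: this is the descent lemma. Taking \<open>F\<close> to be the non-GT loss and
  \<open>v\<close> the GT gradient step gives the inequality for every admissible rate. For the wave factor,
  the relative error \<open>\<rho> \<eta>\<close> is
  \<open>\<eta> * (norm (gradient LG \<theta>))\<^sup>2 / loss_reduction LG LG \<eta> \<theta> - 1\<close>.
\<close>

lemma gradient_eqI:
  assumes "GDERIV F x :> D"
  shows "gradient F x = D"
  unfolding gradient_def
proof (rule the_equality)
  fix E assume "GDERIV F x :> E"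
  with assms have "(\<lambda>h. h \<bullet> E) = (\<lambda>h. h \<bullet> D)"
    unfolding gderiv_def by (rule has_derivative_unique[rotated])
  then show "E = D"
    by (metis vector_eq_ldot)
qed (fact assms)

lemma GDERIV_gradient:
  fixes F :: "'a::euclidean_space \<Rightarrow> real"
  assumes "F differentiable at x"
  shows "GDERIV F x :> gradient F x"
proof -
  obtain F' where F': "(F has_derivative F') (at x)"
    using assms by (auto simp: differentiable_def)
  then have "linear F'"
    by (rule has_derivative_linear)
  \<comment> \<open>Riesz representation: \<open>h \<bullet> adjoint F' 1 = F' h * 1\<close>. The
    adjoint identity is where finite dimension enters.\<close>
  then have "F' = (\<lambda>h. h \<bullet> adjoint F' 1)"
    by (simp add: adjoint_works)
  with F' have "GDERIV F x :> adjoint F' 1"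
    by (metis gderiv_def)
  then show ?thesis
    by (metis gradient_eqI)
qed

text \<open>The chain rule reduces to one real variable both the descent lemma and the first-order
  expansion of a loss reduction.\<close>

lemma has_real_derivative_along_line:
  fixes F :: "'a::euclidean_space \<Rightarrow> real"
  assumes "F differentiable at (x + t *\<^sub>R v)"
  shows "((\<lambda>t. F (x + t *\<^sub>R v)) has_real_derivative gradient F (x + t *\<^sub>R v) \<bullet> v) (at t)"
proof -
  have "((\<lambda>t. x + t *\<^sub>R v) has_derivative (\<lambda>h. h *\<^sub>R v)) (at t)"
    by (auto intro!: derivative_eq_intros)
  from has_derivative_compose[OF this GDERIV_gradient[OF assms, unfolded gderiv_def]]
  show ?thesis
    by (rule has_derivative_imp_has_field_derivative) (simp add: inner_commute)
qed

lemma descent_lemma: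
  fixes F :: "'a::euclidean_space \<Rightarrow> real"
  assumes diff: "\<And>z. F differentiable at z" and smooth: "beta_smooth \<beta> F"
  shows "F (x + v) \<le> F x + gradient F x \<bullet> v + \<beta> / 2 * (norm v)\<^sup>2"
proof -
  define \<psi> where "\<psi> t = F (x + t *\<^sub>R v) - t * (gradient F x \<bullet> v) - \<beta> / 2 * t\<^sup>2 * (norm v)\<^sup>2" for t
  have "\<psi> 1 \<le> \<psi> 0"
  proof (rule DERIV_nonpos_imp_nonincreasing[where f = \<psi>])
    fix t :: real assume "0 \<le> t" "t \<le> 1"
    let ?d = "gradient F (x + t *\<^sub>R v) - gradient F x"
    have "(\<psi> has_real_derivative ?d \<bullet> v - \<beta> * t * (norm v)\<^sup>2) (at t)"
      unfolding \<psi>_def using has_real_derivative_along_line[OF diff]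
      by (auto intro!: derivative_eq_intros simp: inner_diff_left)
    moreover have "?d \<bullet> v \<le> \<beta> * t * (norm v)\<^sup>2"
    proof -
      have "?d \<bullet> v \<le> norm ?d * norm v"
        by (rule norm_cauchy_schwarz)
      \<comment> \<open>The two points are at distance \<open>t * norm v\<close>, since
        \<open>0 \<le> t\<close>. This factor \<open>t\<close> is the derivative of
        \<open>t\<^sup>2 / 2\<close>, hence the constant \<open>\<beta> / 2\<close>.\<close>
      also have "\<dots> \<le> \<beta> * norm ((x + t *\<^sub>R v) - x) * norm v"
        using smooth unfolding beta_smooth_def by (blast intro: mult_right_mono norm_ge_zero)
      finally show ?thesis
        using \<open>0 \<le> t\<close> by (simp add: power2_eq_square mult.assoc)
    qed
    ultimately show "\<exists>D. (\<psi> has_real_derivative D) (at t) \<and> D \<le> 0"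
      by (metis diff_le_0_iff_le)
  qed simp
  then show ?thesis
    by (simp add: \<psi>_def)
qed

text \<open>Stated for every real \<open>\<eta>\<close>, so that it serves both the fixed rate of
  the theorem and the limit of small rates.\<close>

lemma loss_reduction_ge:
  fixes LN LG :: "'a::euclidean_space \<Rightarrow> real"
  assumes "\<And>z. LN differentiable at z" and "beta_smooth \<beta> LN" and "gradient LG \<theta> \<noteq> 0"
  shows "loss_reduction LN LG \<eta> \<theta>
    \<ge> \<eta> * (grad_coupling LN LG \<theta> - \<beta> * \<eta> / 2) * (norm (gradient LG \<theta>))\<^sup>2"
proof -
  let ?g = "gradient LG \<theta>"
  have "LN (\<theta> + (- \<eta> *\<^sub>R ?g))
      \<le> LN \<theta> + gradient LN \<theta> \<bullet> (- \<eta> *\<^sub>R ?g) + \<beta> / 2 * (norm (- \<eta> *\<^sub>R ?g))\<^sup>2"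
    by (rule descent_lemma[OF assms(1,2)])
  \<comment> \<open>The linear term of the descent lemma thus becomes \<open>- \<eta>\<close> times
    the coupling times \<open>(norm ?g)\<^sup>2\<close>; the quadratic term is
    \<open>\<beta> / 2 * \<eta>\<^sup>2 * (norm ?g)\<^sup>2\<close>.\<close>
  moreover have "gradient LN \<theta> \<bullet> ?g = grad_coupling LN LG \<theta> * (norm ?g)\<^sup>2"
    using assms(3) by (simp add: grad_coupling_def)
  ultimately show ?thesis
    by (simp add: loss_reduction_def grad_step_def power_mult_distrib)
      (simp add: algebra_simps power2_eq_square)
qed

text \<open>Up to sign this is the difference quotient at 0 of \<open>F\<close> along its own
  negative gradient, where the slope is
  \<open>- (norm (gradient F \<theta>))\<^sup>2\<close>.\<close>

lemma loss_reduction_self_quotient_tendsto: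
  fixes F :: "'a::euclidean_space \<Rightarrow> real"
  assumes "F differentiable at \<theta>"
  shows "((\<lambda>\<eta>. loss_reduction F F \<eta> \<theta> / \<eta>) \<longlongrightarrow> (norm (gradient F \<theta>))\<^sup>2) (at_right 0)"
proof -
  let ?g = "gradient F \<theta>"
  have "((\<lambda>t. F (\<theta> + t *\<^sub>R (- ?g))) has_real_derivative - (norm ?g)\<^sup>2) (at 0)"
    using has_real_derivative_along_line[of F \<theta> 0 "- ?g"] assms
    by (simp add: power2_norm_eq_inner)
  then have "((\<lambda>t. (F (\<theta> - t *\<^sub>R ?g) - F \<theta>) / t) \<longlongrightarrow> - (norm ?g)\<^sup>2) (at 0)"
    by (simp add: DERIV_def)
  then have "((\<lambda>t. - ((F (\<theta> - t *\<^sub>R ?g) - F \<theta>) / t)) \<longlongrightarrow> - (- (norm ?g)\<^sup>2)) (at_right 0)"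
    by (intro tendsto_minus) (simp add: filterlim_at_split)
  then show ?thesis
    by (simp add: loss_reduction_def grad_step_def minus_divide_left)
qed

text \<open>The numerator is bounded exactly by \<open>loss_reduction_ge\<close>; all asymptotics
  come from the denominator, through its quotient by \<open>\<eta>\<close>.\<close>

lemma wave_bound_first_orderI:
  fixes LN LG :: "'a::euclidean_space \<Rightarrow> real"
  assumes LN: "\<And>z. LN differentiable at z" "beta_smooth \<beta> LN"
    and LG: "LG differentiable at \<theta>" "gradient LG \<theta> \<noteq> 0"
  shows "wave_bound_first_order LN LG \<theta> (grad_coupling LN LG \<theta>) \<beta>"
proof -
  let ?\<gamma> = "grad_coupling LN LG \<theta>"
  define n where "n = (norm (gradient LG \<theta>))\<^sup>2"
  define \<Delta> where "\<Delta> \<eta> = loss_reduction LG LG \<eta> \<theta>" for \<eta>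
  define \<rho> where "\<rho> \<eta> = \<eta> * n / \<Delta> \<eta> - 1" for \<eta>
  have n: "n > 0"
    using LG(2) by (simp add: n_def)
  have lim: "((\<lambda>\<eta>. \<Delta> \<eta> / \<eta>) \<longlongrightarrow> n) (at_right 0)"
    unfolding \<Delta>_def n_def by (rule loss_reduction_self_quotient_tendsto[OF LG(1)])
  have pos: "\<forall>\<^sub>F \<eta> in at_right 0. (0::real) < \<eta>"
    by (rule eventually_at_right_less)
  have bound: "\<eta> * (?\<gamma> - \<beta> * \<eta> / 2) * n \<le> loss_reduction LN LG \<eta> \<theta>" for \<eta>
    unfolding n_def by (rule loss_reduction_ge[OF LN LG(2)])
  have "(\<lambda>\<eta>. \<Delta> \<eta> - \<eta> * n) \<in> o[at_right 0](\<lambda>\<eta>. \<eta>)"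
  proof (rule smalloI_tendsto)
    have "((\<lambda>\<eta>. \<Delta> \<eta> / \<eta> - n) \<longlongrightarrow> 0) (at_right 0)"
      using tendsto_diff[OF lim tendsto_const[of n]] by simp
    \<comment> \<open>Positivity of \<open>\<eta>\<close> matters: at 0, where division yields 0,
      the left side is \<open>- n\<close> and the right side 0.\<close>
    moreover have "\<forall>\<^sub>F \<eta> in at_right 0. \<Delta> \<eta> / \<eta> - n = (\<Delta> \<eta> - \<eta> * n) / \<eta>"
      using pos by eventually_elim (simp add: field_simps)
    ultimately show "((\<lambda>\<eta>. (\<Delta> \<eta> - \<eta> * n) / \<eta>) \<longlongrightarrow> 0) (at_right 0)"
      by (rule Lim_transform_eventually)
    show "\<forall>\<^sub>F \<eta> in at_right 0. \<eta> \<noteq> (0::real)"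
      using pos by eventually_elim simp
  qed
  moreover have "?\<gamma> - \<beta> * \<eta> / 2 \<le> loss_reduction LN LG \<eta> \<theta> / (\<eta> * n)" if "0 < \<eta>" for \<eta>
    using bound[of \<eta>] that n by (simp add: pos_le_divide_eq mult_ac)
  moreover have "(\<rho> \<longlongrightarrow> 0) (at_right 0)"
  proof -
    \<comment> \<open>\<open>\<eta> * n / \<Delta> \<eta>\<close> is \<open>n\<close> divided by a
      quotient that tends to \<open>n\<close>, which is nonzero.\<close>
    have "((\<lambda>\<eta>. n / (\<Delta> \<eta> / \<eta>) - 1) \<longlongrightarrow> n / n - 1) (at_right 0)"
      using n by (intro tendsto_intros lim) simp
    then show ?thesis
      using n by (simp add: \<rho>_def[abs_def] mult.commute)
  qed
  moreover have "\<forall>\<^sub>F \<eta> in at_right 0. \<Delta> \<eta> > 0 \<and>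
      wave_factor LN LG \<eta> \<theta> \<ge> (?\<gamma> - \<beta> * \<eta> / 2) * (1 + \<rho> \<eta>)"
    \<comment> \<open>Near 0 the quotient \<open>\<Delta> \<eta> / \<eta>\<close> is positive
      because its limit is, so \<open>\<Delta> \<eta>\<close> is positive for small positive
      rates.\<close>
    using order_tendstoD(1)[OF lim n] pos
  proof eventually_elim
    case (elim \<eta>)
    then have "\<Delta> \<eta> > 0"
      by (simp add: zero_less_divide_iff)
    \<comment> \<open>Multiplying by \<open>1 + \<rho> \<eta>\<close> exchanges the first-order
      denominator \<open>\<eta> * n\<close> for the true one,
      \<open>\<Delta> \<eta>\<close>.\<close>
    moreover have "(?\<gamma> - \<beta> * \<eta> / 2) * (1 + \<rho> \<eta>) = \<eta> * (?\<gamma> - \<beta> * \<eta> / 2) * n / \<Delta> \<eta>"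
      by (simp add: \<rho>_def)
    moreover have "\<dots> \<le> wave_factor LN LG \<eta> \<theta>"
      unfolding wave_factor_def \<Delta>_def[symmetric]
      using bound \<open>\<Delta> \<eta> > 0\<close> by (intro divide_right_mono) auto
    ultimately show ?case
      by simp
  qed
  ultimately show ?thesis
    unfolding wave_bound_first_order_def n_def[symmetric] \<Delta>_def[symmetric] by blast
qed

theorem theorem3:
  fixes T :: "('v::finite, 'd::finite, 'k::finite, 'p::finite) transformer"
    and L m :: nat
    and f :: "real ^ 'p \<Rightarrow> 'v list \<Rightarrow> real ^ 'v"
    and y :: "nat \<Rightarrow> 'v"
    and G Gbar :: "nat set"
    and LG LGbar :: "real ^ 'p \<Rightarrow> real"
    and \<theta> \<theta>' :: "real ^ 'p"
    and \<beta> \<gamma> \<eta> :: real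
  assumes "prompt T \<noteq> []"
    and "f = run_transformer T L"
    and "G \<union> Gbar = {1..m}" and "G \<inter> Gbar = {}" and "G \<noteq> {}" and "Gbar \<noteq> {}"
    and "LG = avg_loss f y G" and "LGbar = avg_loss f y Gbar"
    and "LG differentiable_on UNIV" and "LGbar differentiable_on UNIV"
    and "gradient LG \<theta> \<noteq> 0"
    and "\<gamma> = grad_coupling LGbar LG \<theta>"
    and "\<beta> > 0" and "beta_smooth \<beta> LGbar"
    and "\<gamma> > 0"
    and "0 < \<eta>" and "\<eta> < 2 * \<gamma> / \<beta>"
    and "\<theta>' = grad_step LG \<eta> \<theta>"
  shows "LGbar \<theta>' \<le> LGbar \<theta> - \<eta> * (\<gamma> - \<beta> * \<eta> / 2) * (norm (gradient LG \<theta>))\<^sup>2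
    \<and> LGbar \<theta> - LGbar \<theta>' \<ge> \<eta> * (\<gamma> - \<beta> * \<eta> / 2) * (norm (gradient LG \<theta>))\<^sup>2
    \<and> \<eta> * (\<gamma> - \<beta> * \<eta> / 2) * (norm (gradient LG \<theta>))\<^sup>2 > 0
    \<and> wave_bound_first_order LGbar LG \<theta> \<gamma> \<beta>"
proof -
  have diff: "LG differentiable at z" "LGbar differentiable at z" for z
    using assms(9,10) by (auto simp: differentiable_on_def)
  have "LGbar \<theta> - LGbar \<theta>' \<ge> \<eta> * (\<gamma> - \<beta> * \<eta> / 2) * (norm (gradient LG \<theta>))\<^sup>2"
    using loss_reduction_ge[OF diff(2) \<open>beta_smooth \<beta> LGbar\<close> \<open>gradient LG \<theta> \<noteq> 0\<close>, of \<eta>]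
    unfolding loss_reduction_def \<open>\<gamma> = _\<close> \<open>\<theta>' = _\<close> .
  \<comment> \<open>As \<open>\<beta>\<close> is positive, (A3) bounds \<open>\<eta>\<close> by the
    zero of this factor.\<close>
  moreover have "\<gamma> - \<beta> * \<eta> / 2 > 0"
    using \<open>\<eta> < 2 * \<gamma> / \<beta>\<close> \<open>\<beta> > 0\<close> by (simp add: field_simps)
  then have "\<eta> * (\<gamma> - \<beta> * \<eta> / 2) * (norm (gradient LG \<theta>))\<^sup>2 > 0"
    using \<open>0 < \<eta>\<close> \<open>gradient LG \<theta> \<noteq> 0\<close> by simp
  moreover have "wave_bound_first_order LGbar LG \<theta> \<gamma> \<beta>"
    unfolding \<open>\<gamma> = _\<close>
    by (rule wave_bound_first_orderI[OF diff(2) \<open>beta_smooth \<beta> LGbar\<close> diff(1) \<open>gradient LG \<theta> \<noteq> 0\<close>])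
  ultimately show ?thesis
    by linarith
qed

end
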